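(* Let $(X,d)$ be a proper metric space which admits a geodesic bicombing. Then the map $$\Sigma(A,B,t)=\bigg(\bigcup_{a\in A}\bigcup_{u\in P_B(a)}\omega(a,u,t)\bigg)\cup\bigg(\bigcup_{b\in B}\bigcup_{v\in P_A(b)}\omega(v,b,t)\bigg),\qquad A,B\in K(X),\ t\in[0,1],$$ defines a geodesic bicombing on $(K(X),d_H)$.
   Context: A geodesic bicombing on a metric space $(Y,\rho)$ is a function $\sigma:Y\times Y\times[0,1]\to Y$ such that for all $x,y\in Y$ and $s,t\in[0,1]$: $\sigma(x,y,0)=x$, $\sigma(x,y,1)=y$, and $\rho(\sigma(x,y,s),\sigma(x,y,t))=|t-s|\rho(x,y)$. A metric space is proper if its closed bounded subsets are compact. $K(X)$ is the set of nonempty compact subsets of $X$, equipped with the Hausdorff metric $d_H(A,B)=\inf\{\varepsilon>0: A\subseteq N_\varepsilon(B)\text{ and }B\subseteq N_\varepsilon(A)\}$, where $N_\varepsilon(A)=\{x\in X: d(x,A)\le\varepsilon\}$ and $d(x,A)=\inf_{a\in A}d(x,a)$. For $A\in K(X)$ and $x\in X$, the metric projection is $P_A(x)=\{a\in A: d(x,a)=d(x,A)\}$. For $a,b\in X$ and $t\in[0,1]$, $\omega(a,b,t)=\{x\in X: d(a,x)=t\,d(a,b)\text{ and }d(x,b)=(1-t)\,d(a,b)\}$. *)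

theory Defs
  imports "HOL-Analysis.Analysis"
begin

text \<open>The carrier is a set rather than a type, so that the same notion applies to a type of class
  \<^class>\<open>metric_space\<close> (carrier \<^term>\<open>UNIV\<close>) and to the hyperspace of nonempty compact sets. Being a
  locale extending \<^locale>\<open>Metric_space\<close>, the predicate includes that the carrier with the
  given distance is a metric space.\<close>

locale geodesic_bicombing = Metric_space Y \<rho>
  for Y :: "'a set" and \<rho> :: "'a \<Rightarrow> 'a \<Rightarrow> real" +
  fixes \<sigma> :: "'a \<Rightarrow> 'a \<Rightarrow> real \<Rightarrow> 'a"
  assumes in_space: "\<lbrakk>x \<in> Y; y \<in> Y; t \<in> {0..1}\<rbrakk> \<Longrightarrow> \<sigma> x y t \<in> Y"
    and start_point: "\<lbrakk>x \<in> Y; y \<in> Y\<rbrakk> \<Longrightarrow> \<sigma> x y 0 = x"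
    and end_point: "\<lbrakk>x \<in> Y; y \<in> Y\<rbrakk> \<Longrightarrow> \<sigma> x y 1 = y"
    and geodesic: "\<lbrakk>x \<in> Y; y \<in> Y; s \<in> {0..1}; t \<in> {0..1}\<rbrakk>
      \<Longrightarrow> \<rho> (\<sigma> x y s) (\<sigma> x y t) = \<bar>t - s\<bar> * \<rho> x y"

definition nonempty_compacts :: "'a::metric_space set set" where
  "nonempty_compacts = {A. A \<noteq> {} \<and> compact A}"

definition closed_nbhd :: "real \<Rightarrow> 'a::metric_space set \<Rightarrow> 'a set" where
  "closed_nbhd \<epsilon> A = {x. infdist x A \<le> \<epsilon>}"

text \<open>Unlike a metric on the carrier only, \<^locale>\<open>Metric_space\<close> demands a symmetric nonnegative
  distance on the whole type, whereas \<^term>\<open>Inf {} :: real\<close> is unspecified; hence the value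
  0 outside the nonempty compact sets.\<close>

definition hausdorff_dist :: "'a::metric_space set \<Rightarrow> 'a set \<Rightarrow> real" where
  "hausdorff_dist A B =
     (if A \<in> nonempty_compacts \<and> B \<in> nonempty_compacts
      then Inf {\<epsilon>. \<epsilon> > 0 \<and> A \<subseteq> closed_nbhd \<epsilon> B \<and> B \<subseteq> closed_nbhd \<epsilon> A} else 0)"

definition metric_proj :: "'a::metric_space set \<Rightarrow> 'a \<Rightarrow> 'a set" where
  "metric_proj A x = {a \<in> A. dist x a = infdist x A}"

definition between_points :: "'a::metric_space \<Rightarrow> 'a \<Rightarrow> real \<Rightarrow> 'a set" where
  "between_points a b t = {x. dist a x = t * dist a b \<and> dist x b = (1 - t) * dist a b}"

definition set_bicombing :: "'a::metric_space set \<Rightarrow> 'a set \<Rightarrow> real \<Rightarrow> 'a set" where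
  "set_bicombing A B t =
     (\<Union>a\<in>A. \<Union>u\<in>metric_proj B a. between_points a u t) \<union>
     (\<Union>b\<in>B. \<Union>v\<in>metric_proj A b. between_points v b t)"

end

theory Submission
  imports Defs
begin

text \<open>Moving along a shortest path from a point \<open>a\<close> of one set to a nearest point \<open>u\<close> of the other
  has speed \<open>d(a,u) \<le> d\<^sub>H(A,B)\<close>. Every point of \<open>\<omega>(a,u,s)\<close> lies on such a path, because a geodesic
  from \<open>a\<close> to it and a geodesic from it to \<open>u\<close> fit together; so it has a partner in
  \<open>\<omega>(a,u,t)\<close> at distance at most \<open>\<bar>t - s\<bar> d\<^sub>H(A,B)\<close> (\<open>between_points_transfer\<close>). Hence the curve
  \<open>t \<mapsto> \<Sigma>(A,B,t)\<close> is Lipschitz with constant \<open>d\<^sub>H(A,B)\<close> (\<open>hausdorff_dist_set_bicombing_le\<close>). It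
  runs from \<open>A\<close> to \<open>B\<close>, so by the triangle inequality none of its parts can be shorter than the
  Lipschitz bound, and the estimate is an equality
  (\<open>Lipschitz_between_endpoints_imp_geodesic\<close>). The curve stays in the hyperspace because
  \<open>\<Sigma>(A,B,t)\<close> is a union of two projections of sets that closed conditions cut out of a compact
  product of \<open>A\<close>, \<open>B\<close> and a closed ball (\<open>compact_set_bicombing\<close>); properness gives compactness
  of the ball.\<close>

section \<open>The Hausdorff metric on nonempty compact sets\<close>

lemma infdist_attained_compact:
  fixes A :: "'a::metric_space set"
  assumes "A \<in> nonempty_compacts"
  shows "\<exists>a\<in>A. dist x a = infdist x A"
proof -
  have A: "compact A" "A \<noteq> {}" using assms by (auto simp: nonempty_compacts_def)
  have "continuous_on A (\<lambda>a. dist x a)" by (intro continuous_intros)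
  then obtain a where a: "a \<in> A" "\<And>b. b \<in> A \<Longrightarrow> dist x a \<le> dist x b"
    using continuous_attains_inf[OF A] by metis
  have "dist x a \<le> infdist x A"
    using A(2) a(2) by (auto simp: infdist_notempty intro: cINF_greatest)
  with infdist_le[OF a(1), of x] a(1) show ?thesis by force
qed

text \<open>Since the \<open>\<epsilon>\<close>-neighbourhoods are closed ones, the inclusions persist when \<open>\<epsilon>\<close> decreases to
  the infimum, and nearest points exist in compact sets. From here on, estimates of the Hausdorff
  distance amount to finding partners, without infima.\<close>

lemma hausdorff_dist_le_iff:
  fixes A B :: "'a::metric_space set"
  assumes A: "A \<in> nonempty_compacts" and B: "B \<in> nonempty_compacts" and r: "0 \<le> r"
  shows "hausdorff_dist A B \<le> r \<longleftrightarrow>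
    (\<forall>a\<in>A. \<exists>b\<in>B. dist a b \<le> r) \<and> (\<forall>b\<in>B. \<exists>a\<in>A. dist b a \<le> r)"
proof -
  define E where "E = {\<epsilon>. \<epsilon> > 0 \<and> A \<subseteq> closed_nbhd \<epsilon> B \<and> B \<subseteq> closed_nbhd \<epsilon> A}"
  have hd: "hausdorff_dist A B = Inf E"
    using A B by (simp add: hausdorff_dist_def E_def)
  have bdd: "bdd_below E" unfolding E_def by (rule bdd_belowI[of _ 0]) auto
  have near: "infdist x C \<le> e \<longleftrightarrow> (\<exists>c\<in>C. dist x c \<le> e)"
    if "C \<in> nonempty_compacts" for x e and C :: "'a set"
    using infdist_attained_compact[OF that, of x] infdist_le2[of _ C x e] by metis
  have compacts: "compact A" "compact B" "A \<noteq> {}" "B \<noteq> {}"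
    using A B by (auto simp: nonempty_compacts_def)
  have "E \<noteq> {}"
  proof -
    have "bounded ((\<lambda>a. infdist a B) ` A)" "bounded ((\<lambda>b. infdist b A) ` B)"
      using compacts
      by (auto intro!: compact_imp_bounded compact_continuous_image continuous_intros)
    then obtain M N where "\<And>a. a \<in> A \<Longrightarrow> infdist a B \<le> M" "\<And>b. b \<in> B \<Longrightarrow> infdist b A \<le> N"
      by (auto simp: bounded_real) (metis abs_le_D1)
    then have "max 1 (max M N) \<in> E"
      by (force simp: E_def closed_nbhd_def)
    then show ?thesis by blast
  qed
  have mono: "e' \<in> E" if "e \<in> E" "e \<le> e'" for e e'
    using that by (force simp: E_def closed_nbhd_def)
  have "Inf E \<le> r \<longleftrightarrow> (\<forall>a\<in>A. infdist a B \<le> r) \<and> (\<forall>b\<in>B. infdist b A \<le> r)" (is "_ \<longleftrightarrow> ?N")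
  proof
    assume le: "Inf E \<le> r"
    have E: "r + e \<in> E" if "e > 0" for e
    proof -
      have "Inf E < r + e" using le that by simp
      then obtain e' where "e' \<in> E" "e' < r + e"
        using cInf_lessD[OF \<open>E \<noteq> {}\<close>] by blast
      then show ?thesis using mono[of e' "r + e"] by simp
    qed
    have "infdist a B \<le> r + e" if "e > 0" "a \<in> A" for a e
      using E[OF that(1)] that(2) by (auto simp: E_def closed_nbhd_def)
    moreover have "infdist b A \<le> r + e" if "e > 0" "b \<in> B" for b e
      using E[OF that(1)] that(2) by (auto simp: E_def closed_nbhd_def)
    ultimately show ?N by (meson field_le_epsilon)
  next
    assume N: ?N
    show "Inf E \<le> r"
    proof (rule field_le_epsilon)
      fix e :: real assume "e > 0"
      then have "r + e \<in> E" using N r by (force simp: E_def closed_nbhd_def)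
      then show "Inf E \<le> r + e" using bdd by (rule cInf_lower)
    qed
  qed
  then show ?thesis by (simp add: hd near[OF A] near[OF B])
qed

lemma hausdorff_dist_nonneg: "0 \<le> hausdorff_dist A B"
proof (cases "A \<in> nonempty_compacts \<and> B \<in> nonempty_compacts")
  case True
  \<comment> \<open>A negative distance would force partners at distance 0, and thus equal sets, for which
    all \<open>\<epsilon> > 0\<close> qualify.\<close>
  show ?thesis
  proof (rule ccontr)
    assume neg: "\<not> 0 \<le> hausdorff_dist A B"
    then have "(\<forall>a\<in>A. \<exists>b\<in>B. dist a b \<le> 0) \<and> (\<forall>b\<in>B. \<exists>a\<in>A. dist b a \<le> 0)"
      using hausdorff_dist_le_iff[of A B 0] True by simp
    then have "A = B" by auto
    then have "hausdorff_dist A B = Inf {0<..}"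
      using True by (auto simp: hausdorff_dist_def closed_nbhd_def greaterThan_def
          intro!: arg_cong[where f = Inf])
    with neg show False by simp
  qed
qed (simp only: hausdorff_dist_def if_False order_refl)

lemma hausdorff_dist_partner:
  assumes "A \<in> nonempty_compacts" "B \<in> nonempty_compacts" "a \<in> A"
  shows "\<exists>b\<in>B. dist a b \<le> hausdorff_dist A B"
  using hausdorff_dist_le_iff[OF assms(1,2) hausdorff_dist_nonneg[of A B]] assms(3) by blast

lemma hausdorff_dist_commute: "hausdorff_dist A B = hausdorff_dist B A"
  by (auto simp: hausdorff_dist_def conj_ac)

lemma hausdorff_dist_triangle:
  assumes A: "A \<in> nonempty_compacts" and B: "B \<in> nonempty_compacts" and C: "C \<in> nonempty_compacts"
  shows "hausdorff_dist A C \<le> hausdorff_dist A B + hausdorff_dist B C"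
proof -
  have via_B: "\<exists>c\<in>C'. dist a c \<le> hausdorff_dist A' B + hausdorff_dist B C'"
    if A': "A' \<in> nonempty_compacts" and C': "C' \<in> nonempty_compacts" and a: "a \<in> A'" for A' C' a
  proof -
    obtain b where "b \<in> B" "dist a b \<le> hausdorff_dist A' B"
      using hausdorff_dist_partner[OF A' B a] by blast
    moreover from \<open>b \<in> B\<close> obtain c where "c \<in> C'" "dist b c \<le> hausdorff_dist B C'"
      using hausdorff_dist_partner[OF B C'] by blast
    ultimately show ?thesis using dist_triangle[of a c b] by force
  qed
  show ?thesis
    using via_B[OF A C] via_B[OF C A]
    by (subst hausdorff_dist_le_iff[OF A C])
      (auto simp: hausdorff_dist_nonneg hausdorff_dist_commute[of C] hausdorff_dist_commute[of B A]
         add.commute)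
qed

lemma Metric_space_hausdorff:
  "Metric_space (nonempty_compacts :: 'a::metric_space set set) hausdorff_dist"
proof
  fix A B :: "'a set"
  assume AB: "A \<in> nonempty_compacts" "B \<in> nonempty_compacts"
  have "hausdorff_dist A B = 0 \<longleftrightarrow> hausdorff_dist A B \<le> 0"
    using hausdorff_dist_nonneg[of A B] by linarith
  also have "\<dots> \<longleftrightarrow> A = B"
    unfolding hausdorff_dist_le_iff[OF AB order_refl] by auto
  finally show "hausdorff_dist A B = 0 \<longleftrightarrow> A = B" .
qed (simp_all add: hausdorff_dist_nonneg hausdorff_dist_triangle, rule hausdorff_dist_commute)

section \<open>Points between two points\<close>

text \<open>Reversal of paths; it turns statements about moving towards the end point into statements
  about moving towards the starting point, and later exchanges the two unions in the definition
  of \<open>\<Sigma>\<close>.\<close>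

lemma between_points_flip: "between_points a b t = between_points b a (1 - t)"
  by (auto simp: between_points_def dist_commute)

text \<open>For \<open>t \<le> s\<close> the partner of \<open>x\<close> is taken on a geodesic from \<open>a\<close> to \<open>x\<close>. Its distances to
  \<open>a\<close> and \<open>x\<close> are then known, and the distance to \<open>b\<close> is forced by the triangle inequality: via
  \<open>x\<close> it is at most, and because of \<open>d(a,b)\<close> at least, \<open>(1 - t) d(a,b)\<close>. The case \<open>t > s\<close> is the
  same one after reversal.\<close>

lemma between_points_transfer:
  fixes a b :: "'a::metric_space"
  assumes \<sigma>: "geodesic_bicombing (UNIV :: 'a set) dist \<sigma>"
    and x: "x \<in> between_points a b s" and s: "s \<in> {0..1}" and t: "t \<in> {0..1}"
  shows "\<exists>y\<in>between_points a b t. dist x y \<le> \<bar>t - s\<bar> * dist a b"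
proof -
  interpret geodesic_bicombing "UNIV :: 'a set" dist \<sigma> by (rule \<sigma>)
  have towards_start: "\<exists>y\<in>between_points a b t. dist x y \<le> (s - t) * dist a b"
    if x: "x \<in> between_points a b s" and "0 \<le> t" "t \<le> s" for a b x :: 'a and s t :: real
  proof (cases "s = t")
    case True
    then show ?thesis using x by auto
  next
    case False
    with that have "0 < s" "t / s \<in> {0..1}" by auto
    define y where "y = \<sigma> a x (t / s)"
    have ax: "dist a x = s * dist a b" and xb: "dist x b = (1 - s) * dist a b"
      using x by (auto simp: between_points_def)
    have "dist a y = t / s * dist a x"
      using geodesic[of a x 0 "t / s"] start_point[of a x] \<open>t / s \<in> {0..1}\<close> \<open>0 \<le> t\<close> \<open>0 < s\<close> by (simp add: y_def)
    then have ay: "dist a y = t * dist a b" using ax \<open>0 < s\<close> by simp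
    have "dist y x = (1 - t / s) * dist a x"
      using geodesic[of a x "t / s" 1] end_point[of a x] \<open>t / s \<in> {0..1}\<close> by (simp add: y_def)
    moreover have "(1 - t / s) * s = s - t" using \<open>0 < s\<close> by (simp add: field_simps)
    ultimately have yx: "dist y x = (s - t) * dist a b"
      by (simp add: ax mult.assoc[symmetric])
    have "dist y b = (1 - t) * dist a b"
      using dist_triangle[of y b x] dist_triangle[of a b y] ay yx xb by (simp add: algebra_simps)
    with ay yx show ?thesis
      by (intro bexI[of _ y]) (auto simp: between_points_def dist_commute)
  qed
  show ?thesis
  proof (cases "t \<le> s")
    case True
    then show ?thesis using towards_start[OF x] t by simp
  next
    case False
    have "x \<in> between_points b a (1 - s)" using x between_points_flip by metis
    from towards_start[OF this, of "1 - t"] False t show ?thesis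
      by (simp add: between_points_flip[of b a] dist_commute[of b a])
  qed
qed

section \<open>The set-valued bicombing\<close>

lemma set_bicombing_flip: "set_bicombing A B t = set_bicombing B A (1 - t)"
  unfolding set_bicombing_def using between_points_flip by (fastforce simp: Un_commute)

lemma metric_proj_nonempty: "A \<in> nonempty_compacts \<Longrightarrow> metric_proj A x \<noteq> {}"
  using infdist_attained_compact by (fastforce simp: metric_proj_def)

lemma set_bicombing_start:
  assumes "B \<in> nonempty_compacts"
  shows "set_bicombing A B 0 = A"
proof -
  have "between_points a b 0 = {a}" for a b :: 'a
    by (auto simp: between_points_def)
  then show ?thesis
    using metric_proj_nonempty[OF assms] by (auto simp: set_bicombing_def metric_proj_def)
qed

lemma set_bicombing_end:
  assumes "A \<in> nonempty_compacts"
  shows "set_bicombing A B 1 = B"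
  using set_bicombing_start[OF assms, of B] set_bicombing_flip[of A B 1] by simp

text \<open>Each of the two unions consists of the points \<open>x\<close> for which some \<open>a\<close> and \<open>u\<close> in the compact
  sets satisfy equations between continuous functions of \<open>(a,u,x)\<close>. Such a set is a projection of a
  closed set of triples, and this set is compact once \<open>x\<close> can be confined to a compact ball.\<close>

lemma compact_set_bicombing:
  fixes A B :: "'a::metric_space set"
  assumes proper: "\<forall>S :: 'a set. closed S \<and> bounded S \<longrightarrow> compact S"
    and A: "compact A" and B: "compact B"
  shows "compact (set_bicombing A B t)"
proof -
  have half: "compact (\<Union>a\<in>A. \<Union>u\<in>metric_proj B a. between_points a u t)"
    if A: "compact A" and B: "compact B" for A B :: "'a set" and t
  proof -
    have "bounded (\<Union>a\<in>A. \<Union>u\<in>metric_proj B a. between_points a u t)"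
    proof -
      have "bounded (A \<union> B)" using A B by (simp add: compact_imp_bounded)
      then obtain M where M: "\<And>p q. p \<in> A \<union> B \<Longrightarrow> q \<in> A \<union> B \<Longrightarrow> dist p q \<le> M"
        by (metis bounded_two_points)
      obtain c R where R: "\<And>a. a \<in> A \<Longrightarrow> dist c a \<le> R"
        using compact_imp_bounded[OF A] unfolding bounded_def by blast
      have "dist c x \<le> R + \<bar>t\<bar> * M"
        if "a \<in> A" "u \<in> metric_proj B a" "x \<in> between_points a u t" for a u x
      proof -
        have "dist a x = t * dist a u" using that by (simp add: between_points_def)
        also have "\<dots> \<le> \<bar>t\<bar> * M"
          using M[of a u] that by (intro mult_mono) (auto simp: metric_proj_def infdist_nonneg)
        finally show ?thesis using dist_triangle[of c x a] R[OF that(1)] by linarith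
      qed
      then show ?thesis
        unfolding bounded_def by (intro exI[of _ c] exI[of _ "R + \<bar>t\<bar> * M"]) blast
    qed
    then obtain c r where ball:
      "(\<Union>a\<in>A. \<Union>u\<in>metric_proj B a. between_points a u t) \<subseteq> cball c r"
      by (meson bounded_subset_cball)
    define K where "K = A \<times> B \<times> cball c r"
    define F where "F = {(a, u, x). dist a u = infdist a B \<and>
      dist a x = t * dist a u \<and> dist x u = (1 - t) * dist a u}"
    have "compact K" unfolding K_def using A B by (intro compact_Times) (auto simp: proper)
    moreover have "closed F"
      unfolding F_def case_prod_beta
      by (intro closed_Collect_conj closed_Collect_eq continuous_intros)
    ultimately have "compact (K \<inter> F)" by (rule compact_Int_closed)
    then have "compact ((\<lambda>p. snd (snd p)) ` (K \<inter> F))"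
      by (intro compact_continuous_image continuous_intros)
    also have "(\<lambda>p. snd (snd p)) ` (K \<inter> F) =
      (\<Union>a\<in>A. \<Union>u\<in>metric_proj B a. between_points a u t)"
    proof (intro equalityI subsetI)
      fix x assume "x \<in> (\<Union>a\<in>A. \<Union>u\<in>metric_proj B a. between_points a u t)"
      moreover from this ball have "x \<in> cball c r" by blast
      ultimately have "\<exists>a u. (a, u, x) \<in> K \<inter> F"
        by (fastforce simp: K_def F_def metric_proj_def between_points_def)
      then show "x \<in> (\<lambda>p. snd (snd p)) ` (K \<inter> F)" by force
    qed (fastforce simp: K_def F_def metric_proj_def between_points_def)
    finally show ?thesis .
  qed
  have "set_bicombing A B t = (\<Union>a\<in>A. \<Union>u\<in>metric_proj B a. between_points a u t) \<union>
      (\<Union>b\<in>B. \<Union>v\<in>metric_proj A b. between_points b v (1 - t))"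
    unfolding set_bicombing_def by (simp flip: between_points_flip)
  then show ?thesis using half[OF A B] half[OF B A] by (simp add: compact_Un)
qed

text \<open>A shortest path from \<open>a\<close> to a nearest point \<open>u\<close> of \<open>B\<close> has length at most \<open>d\<^sub>H(A,B)\<close>, so the
  partner of \<open>x\<close> in \<open>\<omega>(a,u,t)\<close> is close enough.\<close>

lemma set_bicombing_transfer:
  fixes A B :: "'a::metric_space set"
  assumes \<sigma>: "geodesic_bicombing (UNIV :: 'a set) dist \<sigma>"
    and A: "A \<in> nonempty_compacts" and B: "B \<in> nonempty_compacts"
    and s: "s \<in> {0..1}" and t: "t \<in> {0..1}" and x: "x \<in> set_bicombing A B s"
  shows "\<exists>y\<in>set_bicombing A B t. dist x y \<le> \<bar>t - s\<bar> * hausdorff_dist A B"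
proof -
  have half: "\<exists>y\<in>set_bicombing A B t. dist x y \<le> \<bar>t - s\<bar> * hausdorff_dist A B"
    if A: "A \<in> nonempty_compacts" and B: "B \<in> nonempty_compacts"
      and "a \<in> A" and u: "u \<in> metric_proj B a" and x: "x \<in> between_points a u s"
      and s: "s \<in> {0..1}" and t: "t \<in> {0..1}"
    for A B :: "'a set" and a u x s t
  proof -
    obtain y where y: "y \<in> between_points a u t" "dist x y \<le> \<bar>t - s\<bar> * dist a u"
      using between_points_transfer[OF \<sigma> x s t] by blast
    obtain b where "b \<in> B" "dist a b \<le> hausdorff_dist A B"
      using hausdorff_dist_partner[OF A B \<open>a \<in> A\<close>] by blast
    then have "dist a u \<le> hausdorff_dist A B"
      using u infdist_le2[of b B a] by (simp add: metric_proj_def)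
    then have "\<bar>t - s\<bar> * dist a u \<le> \<bar>t - s\<bar> * hausdorff_dist A B"
      by (rule mult_left_mono) simp
    moreover have "y \<in> set_bicombing A B t"
      using y(1) \<open>a \<in> A\<close> u by (auto simp: set_bicombing_def)
    ultimately show ?thesis using y(2) by force
  qed
  from x consider
      a u where "a \<in> A" "u \<in> metric_proj B a" "x \<in> between_points a u s"
    | b v where "b \<in> B" "v \<in> metric_proj A b" "x \<in> between_points v b s"
    by (auto simp: set_bicombing_def)
  then show ?thesis
  proof cases
    case 1
    then show ?thesis using half[OF A B _ _ _ s t] by blast
  next
    case 2
    then have "x \<in> between_points b v (1 - s)" using between_points_flip by metis
    from half[OF B A 2(1,2) this, of "1 - t"] s t show ?thesis
      by (simp add: set_bicombing_flip[of B A] hausdorff_dist_commute[of B A] abs_minus_commute)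
  qed
qed

lemma set_bicombing_in_nonempty_compacts:
  fixes A B :: "'a::metric_space set"
  assumes proper: "\<forall>S :: 'a set. closed S \<and> bounded S \<longrightarrow> compact S"
    and \<sigma>: "geodesic_bicombing (UNIV :: 'a set) dist \<sigma>"
    and A: "A \<in> nonempty_compacts" and B: "B \<in> nonempty_compacts" and t: "t \<in> {0..1}"
  shows "set_bicombing A B t \<in> nonempty_compacts"
proof -
  obtain a where "a \<in> set_bicombing A B 0"
    using A set_bicombing_start[OF B, of A] by (auto simp: nonempty_compacts_def)
  then have "set_bicombing A B t \<noteq> {}"
    using set_bicombing_transfer[OF \<sigma> A B _ t, of 0] by fastforce
  then show ?thesis
    using compact_set_bicombing[OF proper] A B by (auto simp: nonempty_compacts_def)
qed

lemma hausdorff_dist_set_bicombing_le: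
  fixes A B :: "'a::metric_space set"
  assumes proper: "\<forall>S :: 'a set. closed S \<and> bounded S \<longrightarrow> compact S"
    and \<sigma>: "geodesic_bicombing (UNIV :: 'a set) dist \<sigma>"
    and A: "A \<in> nonempty_compacts" and B: "B \<in> nonempty_compacts"
    and s: "s \<in> {0..1}" and t: "t \<in> {0..1}"
  shows "hausdorff_dist (set_bicombing A B s) (set_bicombing A B t) \<le> \<bar>t - s\<bar> * hausdorff_dist A B"
  using set_bicombing_transfer[OF \<sigma> A B s t] set_bicombing_transfer[OF \<sigma> A B t s]
    set_bicombing_in_nonempty_compacts[OF proper \<sigma> A B s]
    set_bicombing_in_nonempty_compacts[OF proper \<sigma> A B t]
  by (subst hausdorff_dist_le_iff) (auto simp: hausdorff_dist_nonneg abs_minus_commute)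

text \<open>The endpoints of the curve are at distance exactly \<open>L\<close>, so on a subinterval it cannot be
  shorter than the Lipschitz bound: this would leave too much for the two remaining intervals.\<close>

lemma Lipschitz_between_endpoints_imp_geodesic:
  assumes "Metric_space Y \<rho>"
    and in_Y: "\<And>t. t \<in> {0..1} \<Longrightarrow> \<gamma> t \<in> Y"
    and Lip: "\<And>s t. s \<in> {0..1} \<Longrightarrow> t \<in> {0..1} \<Longrightarrow> \<rho> (\<gamma> s) (\<gamma> t) \<le> \<bar>t - s\<bar> * \<rho> (\<gamma> 0) (\<gamma> 1)"
    and s: "s \<in> {0..1}" and t: "t \<in> {0..1::real}"
  shows "\<rho> (\<gamma> s) (\<gamma> t) = \<bar>t - s\<bar> * \<rho> (\<gamma> 0) (\<gamma> 1)"
proof -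
  interpret Metric_space Y \<rho> by fact
  let ?L = "\<rho> (\<gamma> 0) (\<gamma> 1)"
  have ordered: "(t - s) * ?L \<le> \<rho> (\<gamma> s) (\<gamma> t)"
    if "s \<in> {0..1}" "t \<in> {0..1}" "s \<le> t" for s t
  proof -
    have "?L \<le> \<rho> (\<gamma> 0) (\<gamma> s) + (\<rho> (\<gamma> s) (\<gamma> t) + \<rho> (\<gamma> t) (\<gamma> 1))"
      using triangle[of "\<gamma> 0" "\<gamma> s" "\<gamma> 1"] triangle[of "\<gamma> s" "\<gamma> t" "\<gamma> 1"] in_Y that by force
    also have "\<dots> \<le> s * ?L + (\<rho> (\<gamma> s) (\<gamma> t) + (1 - t) * ?L)"
      using Lip[of 0 s] Lip[of t 1] that by (intro add_mono) auto
    finally show ?thesis by (simp add: algebra_simps)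
  qed
  have "\<bar>t - s\<bar> * ?L \<le> \<rho> (\<gamma> s) (\<gamma> t)"
    using ordered[OF s t] ordered[OF t s] by (cases "s \<le> t") (auto simp: commute)
  with Lip[OF s t] show ?thesis by (rule antisym)
qed

theorem proposition5p4:
  assumes proper: "\<And>S :: 'a::metric_space set. closed S \<Longrightarrow> bounded S \<Longrightarrow> compact S"
    and bicombing: "\<exists>\<sigma>. geodesic_bicombing (UNIV :: 'a set) dist \<sigma>"
  shows "geodesic_bicombing (nonempty_compacts :: 'a set set) hausdorff_dist set_bicombing"
proof -
  obtain \<sigma> where \<sigma>: "geodesic_bicombing (UNIV :: 'a set) dist \<sigma>" using bicombing by blast
  have proper': "\<forall>S :: 'a set. closed S \<and> bounded S \<longrightarrow> compact S" using proper by blast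
  note inside = set_bicombing_in_nonempty_compacts[OF proper' \<sigma>]
  show ?thesis
  proof (intro geodesic_bicombing.intro geodesic_bicombing_axioms.intro Metric_space_hausdorff)
    fix A B :: "'a set" and s t :: real
    assume AB: "A \<in> nonempty_compacts" "B \<in> nonempty_compacts" and "s \<in> {0..1}" "t \<in> {0..1}"
    note ends = set_bicombing_start[OF AB(2), of A] set_bicombing_end[OF AB(1), of B]
    show "hausdorff_dist (set_bicombing A B s) (set_bicombing A B t) =
        \<bar>t - s\<bar> * hausdorff_dist A B"
      using Lipschitz_between_endpoints_imp_geodesic[where \<gamma> = "set_bicombing A B",
          OF Metric_space_hausdorff inside[OF AB] _ \<open>s \<in> {0..1}\<close> \<open>t \<in> {0..1}\<close>]
        hausdorff_dist_set_bicombing_le[OF proper' \<sigma> AB]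
      by (simp add: ends)
  qed (use inside set_bicombing_start set_bicombing_end in blast)+
qed

end
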